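(* Let $\mathcal H$ be a nonzero real Hilbert space, let $L>0$, and let $f:\mathcal H\to\mathbb R$ be convex, differentiable and $L$-smooth. Let $x_\star\in\mathcal H$ be a minimizer of $f$. Fix an integer $N\ge 1$ and $R\ge 0$, and let $x_0\in\mathcal H$ satisfy $\|x_0-x_\star\|\le R$. Let $\theta_0=1$ and $\theta_{k+1}=\frac{1+\sqrt{1+4\theta_k^2}}{2}$ for $0\le k<N-1$. Starting from $x_0=y_0=z_0$, define $$y_{k+1}=x_k-\tfrac1L\nabla f(x_k),\qquad z_{k+1}=z_k-\tfrac{2\theta_k}{L}\nabla f(x_k)\qquad(0\le k<N),$$ $$x_{k+1}=\Bigl(1-\tfrac1{\theta_{k+1}}\Bigr)y_{k+1}+\tfrac1{\theta_{k+1}}z_{k+1}\qquad(0\le k<N-1).$$ Then $$f(y_N)-f(x_\star)\le \frac{LR^2}{2\,(2\theta_{N-1}^2+1)}.$$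
   Context: $L$-smooth means $\|\nabla f(x)-\nabla f(y)\|\le L\|x-y\|$ for all $x,y\in\mathcal H$. The iteration is the optimized gradient method (OGM) with reported point $y_N$. *)

theory Defs
  imports "HOL-Analysis.Analysis"
begin

text \<open>The Riesz representative of the Frechet derivative; it is unique when it exists, and it exists
  at every point of differentiability in a complete space (lemma GDERIV_gradient below).\<close>
definition gradient :: "('a::real_inner \<Rightarrow> real) \<Rightarrow> 'a \<Rightarrow> 'a" where
  "gradient f x = (THE D. GDERIV f x :> D)"

definition L_smooth :: "real \<Rightarrow> ('a::real_inner \<Rightarrow> real) \<Rightarrow> bool" where
  "L_smooth L f \<longleftrightarrow> (\<forall>x y. norm (gradient f x - gradient f y) \<le> L * norm (x - y))"

lemma GDERIV_gradient_eq:
  assumes "GDERIV f x :> D"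
  shows "gradient f x = D"
proof -
  have "E = D" if "GDERIV f x :> E" for E
  proof -
    have "(\<lambda>h. inner h E) = (\<lambda>h. inner h D)"
      using that assms has_derivative_unique unfolding gderiv_def by blast
    then have "inner (E - D) E = inner (E - D) D" by metis
    then have "inner (E - D) (E - D) = 0" by (simp add: inner_diff_right)
    then show ?thesis by simp
  qed
  with assms show ?thesis unfolding gradient_def by blast
qed

lemma riesz_representation:
  fixes p :: "'a::{real_inner,complete_space} \<Rightarrow> real"
  assumes "bounded_linear p"
  obtains u where "p = (\<lambda>h. inner h u)"
proof -
  interpret p: bounded_linear p by fact
  define J where "J a = inner a a - 2 * p a" for a
  obtain K where K: "\<And>a. norm (p a) \<le> norm a * K" using p.bounded by blast
  have lower: "- K\<^sup>2 \<le> J a" for a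
  proof -
    have "p a \<le> norm a * K" using K[of a] by simp
    moreover have "0 \<le> (norm a - K)\<^sup>2" by simp
    ultimately show ?thesis
      by (simp add: J_def power2_eq_square algebra_simps flip: power2_norm_eq_inner)
  qed
  define m where "m = (INF a. J a)"
  have bdd: "bdd_below (range J)" unfolding bdd_below_def using lower by blast
  have mle: "m \<le> J a" for a unfolding m_def by (rule cINF_lower[OF bdd]) simp
  have "\<exists>a. J a < m + inverse (real (Suc n))" for n
    using cINF_less_iff[OF _ bdd, of "m + inverse (real (Suc n))"] by (auto simp: m_def)
  then obtain s where s: "\<And>n. J (s n) < m + inverse (real (Suc n))" by metis
  have par: "(norm (a - b))\<^sup>2 \<le> 2 * (J a + J b - 2 * m)" for a b
  proof -
    have "(norm (a - b))\<^sup>2 = 2 * (J a + J b - 2 * J ((1/2) *\<^sub>R (a + b)))"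
      unfolding J_def power2_norm_eq_inner
      by (simp add: p.add p.scaleR inner_simps inner_commute algebra_simps)
    also have "\<dots> \<le> 2 * (J a + J b - 2 * m)"
      by (intro mult_left_mono diff_left_mono mle) simp_all
    finally show ?thesis .
  qed
  have "Cauchy s"
  proof (rule metric_CauchyI)
    fix e :: real assume "0 < e"
    then obtain M where M: "inverse (real (Suc M)) < e\<^sup>2 / 4"
      using reals_Archimedean[of "e\<^sup>2 / 4"] by auto
    have "dist (s i) (s j) < e" if "M \<le> i" "M \<le> j" for i j
    proof -
      have "inverse (real (Suc i)) \<le> inverse (real (Suc M))" "inverse (real (Suc j)) \<le> inverse (real (Suc M))"
        using that by (auto intro!: le_imp_inverse_le)
      then have "J (s i) < m + e\<^sup>2 / 4" "J (s j) < m + e\<^sup>2 / 4"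
        using s[of i] s[of j] M by linarith+
      then have "J (s i) + J (s j) - 2 * m < e\<^sup>2 / 2"
        by linarith
      with par[of "s i" "s j"] have "(norm (s i - s j))\<^sup>2 < e\<^sup>2"
        by simp
      then show ?thesis using \<open>0 < e\<close> by (simp add: dist_norm power2_less_imp_less)
    qed
    then show "\<exists>M. \<forall>i\<ge>M. \<forall>j\<ge>M. dist (s i) (s j) < e" by blast
  qed
  then obtain u where u: "s \<longlonglongrightarrow> u" using Cauchy_convergent convergent_def by blast
  have "(\<lambda>n. J (s n)) \<longlonglongrightarrow> J u"
    unfolding J_def by (intro tendsto_intros u p.tendsto)
  moreover have "(\<lambda>n. m + inverse (real (Suc n))) \<longlonglongrightarrow> m + 0"
    by (intro tendsto_intros LIMSEQ_inverse_real_of_nat)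
  ultimately have "J u \<le> m + 0"
    using s by (intro LIMSEQ_le[where X="\<lambda>n. J (s n)"]) (auto intro: less_imp_le)
  then have Ju: "J u \<le> m" by simp
  have "p h = inner h u" for h
  proof (rule ccontr)
    assume ne: "p h \<noteq> inner h u"
    define d where "d = p h - inner h u"
    define c where "c = inner h h + 1"
    have "c > 0" unfolding c_def using inner_ge_zero[of h] by linarith
    have "J (u + t *\<^sub>R h) = J u - 2 * t * d + t\<^sup>2 * (c - 1)" for t
      unfolding J_def c_def d_def
      by (simp add: p.add p.scaleR inner_simps inner_commute power2_eq_square algebra_simps)
    then have "J (u + (d / c) *\<^sub>R h) = J u - 2 * (d / c) * d + (d / c)\<^sup>2 * (c - 1)" .
    also have "\<dots> = J u - d\<^sup>2 / c - (d / c)\<^sup>2"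
      using \<open>c > 0\<close> by (simp add: field_simps power2_eq_square)
    also have "\<dots> < J u"
    proof -
      have "d \<noteq> 0" using ne by (simp add: d_def)
      then have "d\<^sup>2 / c > 0" "(d / c)\<^sup>2 \<ge> 0" using \<open>c > 0\<close> by simp_all
      then show ?thesis by linarith
    qed
    finally show False using Ju mle[of "u + (d / c) *\<^sub>R h"] by linarith
  qed
  then show thesis using that by blast
qed

lemma GDERIV_gradient:
  fixes f :: "'a::{real_inner,complete_space} \<Rightarrow> real"
  assumes "f differentiable (at x)"
  shows "GDERIV f x :> gradient f x"
proof -
  obtain p where p: "(f has_derivative p) (at x)" using assms by (auto simp: differentiable_def)
  obtain u where "p = (\<lambda>h. inner h u)"
    using riesz_representation has_derivative_bounded_linear[OF p] by blast
  then have "GDERIV f x :> u" using p by (simp add: gderiv_def)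
  then show ?thesis using GDERIV_gradient_eq by blast
qed

end

theory Submission
  imports Defs
begin

text \<open>Put \<open>\<phi> u = f u - \<parallel>\<nabla>f u\<parallel>\<^sup>2 / (2 L)\<close> and \<open>P u = u - \<nabla>f u / L\<close>. For a smooth convex \<open>f\<close> the value
  \<open>\<phi> u\<close> is the value at \<open>P u\<close> of a convex function with subgradient \<open>\<nabla>f u\<close> there
  (lemma \<open>prox_value_above_tangent\<close>): \<open>f\<close> is its Moreau envelope, and a gradient step for \<open>f\<close> is a
  proximal step. In these terms \<open>y\<^sub>k\<^sub>+\<^sub>1 = P x\<^sub>k\<close>, at the minimizer \<open>P x\<^sub>\<star> = x\<^sub>\<star>\<close> and \<open>\<phi> x\<^sub>\<star> = f x\<^sub>\<star>\<close>, and
  with \<open>q = \<parallel>\<nabla>f y\<^sub>N\<parallel>\<^sup>2 / L\<close> the reported value is \<open>f y\<^sub>N = \<phi> y\<^sub>N + q / 2\<close>.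

  Write \<open>c = \<theta>\<^sub>N\<^sub>-\<^sub>1\<^sup>2\<close>. The usual potential argument adds, with weights \<open>2 \<theta>\<^sub>j\<close>, the tangent inequalities
  of \<open>\<phi>\<close> at \<open>x\<^sub>j\<close> tested at \<open>x\<^sub>\<star>\<close>, and, with weights \<open>2 \<theta>\<^sub>j\<^sup>2\<close>, those between consecutive iterates. It
  bounds \<open>2 c (\<phi> x\<^sub>N\<^sub>-\<^sub>1 - f x\<^sub>\<star>) + L/2 \<parallel>z\<^sub>N - x\<^sub>\<star>\<parallel>\<^sup>2\<close> by \<open>L/2 \<parallel>x\<^sub>0 - x\<^sub>\<star>\<parallel>\<^sup>2\<close>, hence gives a rate with the
  denominator \<open>4 c\<close>. Adding the tangent inequality at \<open>y\<^sub>N\<close> tested at \<open>x\<^sub>\<star>\<close> would raise \<open>4 c\<close> to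
  \<open>4 c + 2\<close>, but it introduces a scalar product of \<open>\<nabla>f y\<^sub>N\<close> with \<open>z\<^sub>N - y\<^sub>N\<close> on which the potential has
  no hold.

  The remedy is to test part of the tangent inequalities at the unknown point \<open>P y\<^sub>N\<close> instead of at
  \<open>x\<^sub>\<star>\<close>. Lemma \<open>ogm_potential\<close> therefore keeps the tangent gaps at \<open>x\<^sub>\<star>\<close>. A gap at \<open>x\<^sub>\<star>\<close> minus the
  gap of the same tangent at \<open>P y\<^sub>N\<close> is
  \<open>f x\<^sub>\<star> - \<phi> y\<^sub>N + \<langle>\<nabla>f x\<^sub>j, P y\<^sub>N - x\<^sub>\<star>\<rangle>\<close>. With weights \<open>\<mu>\<^sub>j = \<theta>\<^sub>j\<^sup>2 (2 \<theta>\<^sub>j - 1)\<close> the sums of these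
  differences have a closed form, since
  \<open>\<Sum> \<mu>\<^sub>j = c\<^sup>2\<close> and \<open>\<Sum> \<mu>\<^sub>j \<nabla>f x\<^sub>j = L c (y\<^sub>N - z\<^sub>N)\<close> (lemmas \<open>sum_reroute_weight\<close> and
  \<open>sum_reroute_weight_gradient\<close>), and \<open>\<mu>\<^sub>j / c\<^sup>2 \<le> 2 \<theta>\<^sub>j\<close>, so this much can be rerouted. Thus
  the kept gaps are worth at least \<open>f x\<^sub>\<star> - \<phi> y\<^sub>N + (L/c) \<langle>y\<^sub>N - z\<^sub>N, P y\<^sub>N - x\<^sub>\<star>\<rangle>\<close>. Together with
  \<open>\<phi> y\<^sub>N + q \<le> \<phi> x\<^sub>N\<^sub>-\<^sub>1\<close> and twice the tangent inequality at \<open>y\<^sub>N\<close> tested at \<open>x\<^sub>\<star>\<close>, the value gap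
  \<open>f y\<^sub>N - f x\<^sub>\<star>\<close> gets the total weight \<open>2 c - 1 + 2 = 2 c + 1\<close>, and the remaining quadratic form in
  \<open>z\<^sub>N - x\<^sub>\<star>\<close>, \<open>y\<^sub>N - z\<^sub>N\<close> and \<open>\<nabla>f y\<^sub>N\<close> is a sum of two squares (lemma \<open>final_quadratic_bound\<close>).\<close>

section \<open>Smooth convex functions\<close>

lemma has_real_derivative_along_line:
  fixes f :: "'a::{real_inner,complete_space} \<Rightarrow> real"
  assumes "\<forall>u. f differentiable (at u)"
  shows "((\<lambda>t. f (u + t *\<^sub>R d)) has_real_derivative inner d (gradient f (u + t *\<^sub>R d))) (at t)"
proof -
  have "(f has_derivative (\<lambda>h. inner h (gradient f (u + t *\<^sub>R d)))) (at (u + t *\<^sub>R d))"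
    using GDERIV_gradient assms by (auto simp: gderiv_def)
  moreover have "((\<lambda>t. u + t *\<^sub>R d) has_derivative (\<lambda>s. s *\<^sub>R d)) (at t)"
    by (auto intro!: derivative_eq_intros)
  ultimately have "((\<lambda>t. f (u + t *\<^sub>R d)) has_derivative
      (\<lambda>s. inner (s *\<^sub>R d) (gradient f (u + t *\<^sub>R d)))) (at t)"
    by (rule has_derivative_compose[rotated])
  then show ?thesis
    by (simp add: has_field_derivative_def mult.commute[of _ "inner d _"] cong: if_cong)
qed

text \<open>The claim is one-dimensional: it is the tangent inequality for \<open>f\<close> restricted to the line through
  \<open>v\<close> and \<open>u\<close>.\<close>
lemma convex_above_tangent:
  fixes f :: "'a::{real_inner,complete_space} \<Rightarrow> real"
  assumes convex: "convex_on UNIV f" and diff: "\<forall>u. f differentiable (at u)"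
  shows "f v + inner (gradient f v) (u - v) \<le> f u"
proof -
  define h where "h = (\<lambda>t::real. f (v + t *\<^sub>R (u - v)))"
  have "convex_on UNIV h"
  proof (rule convex_onI)
    fix t a b :: real assume "0 < t" "t < 1"
    moreover have "v + ((1 - t) *\<^sub>R a + t *\<^sub>R b) *\<^sub>R (u - v)
        = (1 - t) *\<^sub>R (v + a *\<^sub>R (u - v)) + t *\<^sub>R (v + b *\<^sub>R (u - v))"
      by (simp add: algebra_simps)
    ultimately show "h ((1 - t) *\<^sub>R a + t *\<^sub>R b) \<le> (1 - t) * h a + t * h b"
      unfolding h_def using convex_onD[OF convex, of t "v + a *\<^sub>R (u - v)" "v + b *\<^sub>R (u - v)"] by simp
  qed simp
  moreover have "(h has_real_derivative inner (u - v) (gradient f v)) (at 0)"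
    using has_real_derivative_along_line[OF diff, of v "u - v" 0] by (simp add: h_def)
  ultimately have "h 1 - h 0 \<ge> inner (u - v) (gradient f v) * (1 - 0)"
    by (intro convex_on_imp_above_tangent[where A = UNIV]) auto
  then show ?thesis by (simp add: h_def inner_commute)
qed

text \<open>On the segment from \<open>u\<close> to \<open>u + d\<close> the parabola grows at least as fast as \<open>f\<close>, because the slope
  of \<open>f\<close> at parameter \<open>t\<close> differs from the slope at \<open>0\<close> by at most \<open>L t \<parallel>d\<parallel>\<^sup>2\<close>.\<close>
lemma smooth_below_parabola:
  fixes f :: "'a::{real_inner,complete_space} \<Rightarrow> real"
  assumes diff: "\<forall>u. f differentiable (at u)" and smooth: "L_smooth L f"
  shows "f (u + d) \<le> f u + inner (gradient f u) d + L / 2 * (norm d)\<^sup>2"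
proof -
  define h where "h t = f (u + t *\<^sub>R d) - t * inner (gradient f u) d - L / 2 * t\<^sup>2 * (norm d)\<^sup>2"
    for t :: real
  have "h 1 \<le> h 0"
  proof (rule DERIV_nonpos_imp_nonincreasing[of 0 1 h])
    fix t :: real assume "0 \<le> t" "t \<le> 1"
    let ?D = "inner d (gradient f (u + t *\<^sub>R d)) - inner (gradient f u) d - L * t * (norm d)\<^sup>2"
    have "(h has_real_derivative ?D) (at t)"
      unfolding h_def
      by (rule derivative_eq_intros has_real_derivative_along_line[OF diff] refl | simp)+
    moreover have "inner d (gradient f (u + t *\<^sub>R d) - gradient f u)
        \<le> norm d * norm (gradient f (u + t *\<^sub>R d) - gradient f u)"
      by (rule norm_cauchy_schwarz)
    moreover have "norm d * norm (gradient f (u + t *\<^sub>R d) - gradient f u) \<le> norm d * (L * (t * norm d))"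
    proof (rule mult_left_mono)
      show "norm (gradient f (u + t *\<^sub>R d) - gradient f u) \<le> L * (t * norm d)"
        using smooth[unfolded L_smooth_def, rule_format, of "u + t *\<^sub>R d" u] \<open>0 \<le> t\<close> by simp
    qed simp
    ultimately show "\<exists>D. (h has_real_derivative D) (at t) \<and> D \<le> 0"
      by (intro exI[of _ ?D]) (simp add: inner_diff_right inner_commute power2_eq_square algebra_simps)
  qed simp
  then show ?thesis by (simp add: h_def)
qed

definition grad_step :: "real \<Rightarrow> ('a::real_inner \<Rightarrow> real) \<Rightarrow> 'a \<Rightarrow> 'a" where
  "grad_step L f x = x - (1 / L) *\<^sub>R gradient f x"

text \<open>If \<open>f\<close> is the Moreau envelope, with parameter \<open>1 / L\<close>, of a convex function, then this is the
  value of that function at the proximal point \<open>grad_step L f x\<close>.\<close>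
definition prox_value :: "real \<Rightarrow> ('a::real_inner \<Rightarrow> real) \<Rightarrow> 'a \<Rightarrow> real" where
  "prox_value L f x = f x - (norm (gradient f x))\<^sup>2 / (2 * L)"

text \<open>This is the interpolation inequality
  \<open>f v + \<langle>\<nabla>f v, u - v\<rangle> + \<parallel>\<nabla>f u - \<nabla>f v\<parallel>\<^sup>2 / (2 L) \<le> f u\<close> of smooth convex functions, rewritten so that no
  squares are left. It comes from comparing the tangent at \<open>v\<close> with the parabola at \<open>u\<close>.\<close>
lemma prox_value_above_tangent:
  fixes f :: "'a::{real_inner,complete_space} \<Rightarrow> real"
  assumes L: "L > 0" and convex: "convex_on UNIV f" and diff: "\<forall>u. f differentiable (at u)"
    and smooth: "L_smooth L f"
  shows "prox_value L f v + inner (gradient f v) (grad_step L f u - grad_step L f v)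
    \<le> prox_value L f u"
proof -
  define a b where "a = gradient f u" and "b = gradient f v"
  \<comment> \<open>The minimizer of the parabola at \<open>u\<close> minus the tangent at \<open>v\<close>.\<close>
  define w where "w = u + (1 / L) *\<^sub>R (b - a)"
  have "f v + inner b (w - v) \<le> f w"
    unfolding b_def by (rule convex_above_tangent[OF convex diff])
  moreover have "f w \<le> f u + inner a ((1 / L) *\<^sub>R (b - a)) + L / 2 * (norm ((1 / L) *\<^sub>R (b - a)))\<^sup>2"
    unfolding a_def w_def by (rule smooth_below_parabola[OF diff smooth])
  moreover have "L / 2 * (norm ((1 / L) *\<^sub>R (b - a)))\<^sup>2 = (norm (b - a))\<^sup>2 / (2 * L)"
    using L by (simp add: power_mult_distrib power_divide power2_eq_square[of L] del: scaleR_diff_right)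
  ultimately have "f v + inner b (w - v) \<le> f u + inner a (b - a) / L + (norm (b - a))\<^sup>2 / (2 * L)"
    by simp
  then show ?thesis
    using L unfolding w_def prox_value_def grad_step_def a_def[symmetric] b_def[symmetric]
      power2_norm_eq_inner
    by (simp add: inner_simps inner_commute field_simps)
qed

text \<open>Otherwise a gradient step from \<open>p\<close> would decrease \<open>f\<close>.\<close>
lemma gradient_at_minimizer:
  fixes f :: "'a::{real_inner,complete_space} \<Rightarrow> real"
  assumes L: "L > 0" and diff: "\<forall>u. f differentiable (at u)" and smooth: "L_smooth L f"
    and min: "\<forall>u. f p \<le> f u"
  shows "gradient f p = 0"
proof -
  let ?g = "gradient f p"
  have "f p \<le> f (p + (- 1 / L) *\<^sub>R ?g)" using min by blast
  also have "\<dots> \<le> f p + inner ?g ((- 1 / L) *\<^sub>R ?g) + L / 2 * (norm ((- 1 / L) *\<^sub>R ?g))\<^sup>2"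
    by (rule smooth_below_parabola[OF diff smooth])
  also have "\<dots> = f p - (norm ?g)\<^sup>2 / (2 * L)"
    using L by (simp add: power2_eq_square field_simps flip: power2_norm_eq_inner)
  finally have "(norm ?g)\<^sup>2 \<le> 0" using L by (simp add: field_simps)
  then show ?thesis by simp
qed

section \<open>The parameters of the method\<close>

lemma theta_ge_1:
  fixes \<theta> :: "nat \<Rightarrow> real"
  assumes theta_0: "\<theta> 0 = 1"
    and theta_Suc: "\<forall>k < N - 1. \<theta> (k + 1) = (1 + sqrt (1 + 4 * (\<theta> k)\<^sup>2)) / 2"
    and "k < N"
  shows "1 \<le> \<theta> k"
proof (cases k)
  case (Suc j)
  define s where "s = sqrt (1 + 4 * (\<theta> j)\<^sup>2)"
  have "1 \<le> s" by (simp add: s_def)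
  moreover have "\<theta> k = (1 + s) / 2" using theta_Suc \<open>k < N\<close> Suc by (simp add: s_def)
  ultimately show ?thesis by simp
qed (simp add: theta_0)

lemma theta_Suc_square:
  fixes \<theta> :: "nat \<Rightarrow> real"
  assumes theta_Suc: "\<forall>k < N - 1. \<theta> (k + 1) = (1 + sqrt (1 + 4 * (\<theta> k)\<^sup>2)) / 2"
    and "Suc k < N"
  shows "(\<theta> (Suc k))\<^sup>2 = \<theta> (Suc k) + (\<theta> k)\<^sup>2"
proof -
  have "2 * \<theta> (Suc k) - 1 = sqrt (1 + 4 * (\<theta> k)\<^sup>2)"
    using theta_Suc[rule_format, of k] \<open>Suc k < N\<close> by (simp add: less_diff_conv)
  then have "(2 * \<theta> (Suc k) - 1)\<^sup>2 = 1 + 4 * (\<theta> k)\<^sup>2" by simp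
  then show ?thesis by (simp add: power2_eq_square algebra_simps)
qed

lemma theta_power2_mono:
  fixes \<theta> :: "nat \<Rightarrow> real"
  assumes ge_1: "\<And>k. k < N \<Longrightarrow> 1 \<le> \<theta> k"
    and square: "\<And>k. Suc k < N \<Longrightarrow> (\<theta> (Suc k))\<^sup>2 = \<theta> (Suc k) + (\<theta> k)\<^sup>2"
    and "j \<le> k" "k < N"
  shows "(\<theta> j)\<^sup>2 \<le> (\<theta> k)\<^sup>2"
  using \<open>j \<le> k\<close> \<open>k < N\<close>
proof (induction k rule: dec_induct)
  case (step k)
  then show ?case using square[of k] ge_1[of "Suc k"] by simp
qed simp

text \<open>At \<open>t = \<theta>\<^sub>j\<close> this is, up to the common factor \<open>1 / c\<^sup>2\<close>, the part of the weight \<open>2 \<theta>\<^sub>j\<close> of the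
  \<open>j\<close>-th tangent inequality that is moved from the minimizer to the last proximal point. It is also the
  increment of \<open>\<theta>\<^sub>j\<^sup>4\<close>, which is why it sums in closed form.\<close>
definition reroute_weight :: "real \<Rightarrow> real" where
  "reroute_weight t = t\<^sup>2 * (2 * t - 1)"

lemma reroute_weight_eq:
  assumes "t\<^sup>2 = t + s\<^sup>2"
  shows "reroute_weight t = (t\<^sup>2)\<^sup>2 - (s\<^sup>2)\<^sup>2"
proof -
  have "s\<^sup>2 = t\<^sup>2 - t" using assms by simp
  show ?thesis
    unfolding reroute_weight_def \<open>s\<^sup>2 = t\<^sup>2 - t\<close> by (simp add: power2_eq_square algebra_simps)
qed

lemma sum_reroute_weight:
  fixes \<theta> :: "nat \<Rightarrow> real"
  assumes theta_0: "\<theta> 0 = 1"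
    and square: "\<And>k. Suc k < N \<Longrightarrow> (\<theta> (Suc k))\<^sup>2 = \<theta> (Suc k) + (\<theta> k)\<^sup>2"
    and "k < N"
  shows "(\<Sum>j\<le>k. reroute_weight (\<theta> j)) = ((\<theta> k)\<^sup>2)\<^sup>2"
  using \<open>k < N\<close>
proof (induction k)
  case 0
  then show ?case by (simp add: theta_0 reroute_weight_def)
next
  case (Suc k)
  then show ?case using reroute_weight_eq[OF square[of k]] by simp
qed

text \<open>No more weight is moved than there is.\<close>
lemma reroute_weight_le:
  assumes "1 \<le> t" "t\<^sup>2 \<le> c"
  shows "reroute_weight t \<le> c\<^sup>2 * (2 * t)"
proof -
  have "t * t \<le> c" "1 \<le> t\<^sup>2" using assms by (simp_all add: power2_eq_square[symmetric])
  then have "t * (2 * t - 1) \<le> 2 * c * 1" using \<open>1 \<le> t\<close> by (simp add: algebra_simps)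
  also have "\<dots> \<le> 2 * c * c" using \<open>1 \<le> t\<^sup>2\<close> \<open>t\<^sup>2 \<le> c\<close> by (intro mult_left_mono) auto
  finally have "t * (t * (2 * t - 1)) \<le> t * (2 * c * c)" using \<open>1 \<le> t\<close> by (intro mult_left_mono) auto
  then show ?thesis by (simp add: reroute_weight_def power2_eq_square algebra_simps)
qed

section \<open>The iteration in terms of gradient steps\<close>

text \<open>The potential is \<open>2 \<theta>\<^sub>k\<^sup>2 (\<phi>\<^sub>k - v) + L/2 \<parallel>z\<^sub>k\<^sub>+\<^sub>1 - u\<parallel>\<^sup>2\<close>. The step that brings in the \<open>k\<close>-th gradient
  lowers it by at least \<open>2 \<theta>\<^sub>k\<close> times the gap of the new tangent at \<open>(u, v)\<close>: the other terms cancel because the recurrence for \<open>P\<close>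
  puts \<open>P\<^sub>k\<close> and \<open>z\<^sub>k\<^sub>+\<^sub>1\<close> into the gradient point in the proportion \<open>\<theta>\<^sub>k\<^sup>2 : \<theta>\<^sub>k\<^sub>+\<^sub>1\<close>. The gaps are
  kept rather than dropped as nonnegative, since the sharp rate depends on them.\<close>
lemma ogm_potential:
  fixes g P z :: "nat \<Rightarrow> 'a::real_inner" and \<phi> \<theta> :: "nat \<Rightarrow> real"
  assumes L: "L > 0" and theta_0: "\<theta> 0 = 1"
    and square: "\<And>k. Suc k < N \<Longrightarrow> (\<theta> (Suc k))\<^sup>2 = \<theta> (Suc k) + (\<theta> k)\<^sup>2"
    and tangent: "\<And>k. Suc k < N \<Longrightarrow> \<phi> (Suc k) + inner (g (Suc k)) (P k - P (Suc k)) \<le> \<phi> k"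
    and P_0: "P 0 = z 0 - (1 / L) *\<^sub>R g 0"
    and P_Suc: "\<And>k. Suc k < N \<Longrightarrow> (\<theta> (Suc k))\<^sup>2 *\<^sub>R P (Suc k) =
        (\<theta> k)\<^sup>2 *\<^sub>R P k + \<theta> (Suc k) *\<^sub>R z (Suc k) - ((\<theta> (Suc k))\<^sup>2 / L) *\<^sub>R g (Suc k)"
    and z_Suc: "\<And>k. k < N \<Longrightarrow> z (Suc k) = z k - (2 * \<theta> k / L) *\<^sub>R g k"
    and "k < N"
  shows "2 * (\<theta> k)\<^sup>2 * (\<phi> k - v) + L / 2 * (norm (z (Suc k) - u))\<^sup>2
    + (\<Sum>j\<le>k. 2 * \<theta> j * (v - \<phi> j - inner (g j) (u - P j))) \<le> L / 2 * (norm (z 0 - u))\<^sup>2"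
proof -
  have dist_step: "L / 2 * (norm (z (Suc k) - u))\<^sup>2 = L / 2 * (norm (z k - u))\<^sup>2
      - 2 * \<theta> k * inner (g k) (z k - u) + 2 * (\<theta> k)\<^sup>2 / L * inner (g k) (g k)" if "k < N" for k
    using L unfolding z_Suc[OF that] power2_norm_eq_inner
    by (simp add: inner_simps inner_commute field_simps power2_eq_square)
  show ?thesis
    using \<open>k < N\<close>
  proof (induction k)
    case 0
    then show ?case
      unfolding dist_step[OF 0] by (simp add: theta_0 P_0 inner_simps algebra_simps)
  next
    case (Suc k)
    let ?t = "\<theta> (Suc k)" and ?g = "g (Suc k)"
    have "?t\<^sup>2 * inner ?g (P (Suc k)) = inner ?g (?t\<^sup>2 *\<^sub>R P (Suc k))" by simp
    also have "\<dots> = (\<theta> k)\<^sup>2 * inner ?g (P k) + ?t * inner ?g (z (Suc k)) - ?t\<^sup>2 / L * inner ?g ?g"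
      unfolding P_Suc[OF Suc.prems] by (simp add: inner_simps)
    finally have inner_P: "?t\<^sup>2 * inner ?g (P (Suc k)) =
      (\<theta> k)\<^sup>2 * inner ?g (P k) + ?t * inner ?g (z (Suc k)) - ?t\<^sup>2 / L * inner ?g ?g" .
    have "2 * (\<theta> k)\<^sup>2 * (\<phi> (Suc k) + inner ?g (P k - P (Suc k))) \<le> 2 * (\<theta> k)\<^sup>2 * \<phi> k"
      by (intro mult_left_mono tangent Suc.prems) simp
    moreover have "2 * ?t\<^sup>2 * inner ?g (P (Suc k)) =
      2 * ?t * inner ?g (P (Suc k)) + 2 * (\<theta> k)\<^sup>2 * inner ?g (P (Suc k))"
      unfolding square[OF Suc.prems] by (simp add: algebra_simps)
    moreover have "2 * ?t\<^sup>2 * (\<phi> (Suc k) - v) =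
      2 * ?t * (\<phi> (Suc k) - v) + 2 * (\<theta> k)\<^sup>2 * (\<phi> (Suc k) - v)"
      unfolding square[OF Suc.prems] by (simp add: algebra_simps)
    ultimately show ?case
      using Suc.IH Suc.prems inner_P unfolding dist_step[OF Suc.prems]
      by (simp add: inner_diff_right algebra_simps)
  qed
qed

text \<open>Multiplied by \<open>\<theta>\<^sub>k\<^sup>2\<close>, the difference of \<open>P\<^sub>k\<close> and \<open>z\<^sub>k\<^sub>+\<^sub>1\<close> telescopes: the multiple
  \<open>\<theta>\<^sub>k\<^sub>+\<^sub>1 - \<theta>\<^sub>k\<^sub>+\<^sub>1\<^sup>2\<close> of \<open>z\<^sub>k\<^sub>+\<^sub>1\<close> that a step leaves over is exactly \<open>- \<theta>\<^sub>k\<^sup>2\<close>. This identity is what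
  determines the weights, since it turns the gradients of all iterates into one known vector.\<close>
lemma sum_reroute_weight_gradient:
  fixes g P z :: "nat \<Rightarrow> 'a::real_inner" and \<theta> :: "nat \<Rightarrow> real"
  assumes L: "L > 0" and theta_0: "\<theta> 0 = 1"
    and square: "\<And>k. Suc k < N \<Longrightarrow> (\<theta> (Suc k))\<^sup>2 = \<theta> (Suc k) + (\<theta> k)\<^sup>2"
    and P_0: "P 0 = z 0 - (1 / L) *\<^sub>R g 0"
    and P_Suc: "\<And>k. Suc k < N \<Longrightarrow> (\<theta> (Suc k))\<^sup>2 *\<^sub>R P (Suc k) =
        (\<theta> k)\<^sup>2 *\<^sub>R P k + \<theta> (Suc k) *\<^sub>R z (Suc k) - ((\<theta> (Suc k))\<^sup>2 / L) *\<^sub>R g (Suc k)"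
    and z_Suc: "\<And>k. k < N \<Longrightarrow> z (Suc k) = z k - (2 * \<theta> k / L) *\<^sub>R g k"
    and "k < N"
  shows "(\<Sum>j\<le>k. reroute_weight (\<theta> j) *\<^sub>R g j) = (L * (\<theta> k)\<^sup>2) *\<^sub>R (P k - z (Suc k))"
  using \<open>k < N\<close>
proof (induction k)
  case 0
  then show ?case using L by (simp add: z_Suc theta_0 P_0 reroute_weight_def algebra_simps scaleR_2)
next
  case (Suc k)
  let ?t = "\<theta> (Suc k)" and ?g = "g (Suc k)" and ?z = "z (Suc k)"
  have "?t\<^sup>2 *\<^sub>R (P (Suc k) - z (Suc (Suc k)))
      = (\<theta> k)\<^sup>2 *\<^sub>R P k + (?t - ?t\<^sup>2) *\<^sub>R ?z + (?t\<^sup>2 * (2 * ?t - 1) / L) *\<^sub>R ?g"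
    unfolding scaleR_diff_right P_Suc[OF Suc.prems] z_Suc[OF Suc.prems]
    by (simp add: algebra_simps diff_divide_distrib)
  also have "?t - ?t\<^sup>2 = - (\<theta> k)\<^sup>2" using square[OF Suc.prems] by simp
  finally have "?t\<^sup>2 *\<^sub>R (P (Suc k) - z (Suc (Suc k)))
      = (\<theta> k)\<^sup>2 *\<^sub>R (P k - ?z) + (reroute_weight ?t / L) *\<^sub>R ?g"
    by (simp add: reroute_weight_def algebra_simps)
  then have "L *\<^sub>R ?t\<^sup>2 *\<^sub>R (P (Suc k) - z (Suc (Suc k)))
      = L *\<^sub>R ((\<theta> k)\<^sup>2 *\<^sub>R (P k - ?z) + (reroute_weight ?t / L) *\<^sub>R ?g)"
    by (rule arg_cong)
  then show ?case using Suc L by (simp add: scaleR_add_right)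
qed

section \<open>The bound\<close>

text \<open>The difference of the two sides is a sum of two squares. One of them vanishes when
  \<open>L (y - z) = c g\<close>, which is the case if all gradients along the run are equal, as on the linear part of
  a Huber function, where the rate is attained.\<close>
lemma final_quadratic_bound:
  fixes g y z p :: "'a::real_inner"
  assumes L: "L > 0" and c: "c \<ge> 1"
  defines "y' \<equiv> y - (1 / L) *\<^sub>R g"
  shows "2 * inner g (y' - p) - inner ((L / c) *\<^sub>R (y - z)) (y' - p)
    \<le> L / 2 * (norm (z - p))\<^sup>2 + (c - 1 / 2) * ((norm g)\<^sup>2 / L)"
proof -
  define D where "D = L *\<^sub>R (y - z) - c *\<^sub>R g"
  define w where "w = z - p"
  have yz: "y - z = (1 / L) *\<^sub>R (c *\<^sub>R g + D)" using L by (simp add: D_def)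
  have G: "2 *\<^sub>R g - (L / c) *\<^sub>R (y - z) = g - (1 / c) *\<^sub>R D"
    unfolding yz using L c by (simp add: algebra_simps scaleR_2)
  have "y' - p = w + (y - z) - (1 / L) *\<^sub>R g" by (simp add: w_def y'_def)
  also have "\<dots> = w + (1 / L) *\<^sub>R ((c - 1) *\<^sub>R g + D)"
    unfolding yz by (simp add: algebra_simps)
  finally have y': "y' - p = w + (1 / L) *\<^sub>R ((c - 1) *\<^sub>R g + D)" .
  have "L / 2 * (norm w)\<^sup>2 + (c - 1 / 2) * ((norm g)\<^sup>2 / L)
      - inner (g - (1 / c) *\<^sub>R D) (w + (1 / L) *\<^sub>R ((c - 1) *\<^sub>R g + D))
    = L / 2 * (norm (w - (1 / L) *\<^sub>R (g - (1 / c) *\<^sub>R D)))\<^sup>2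
      + (2 * c - 1) / (2 * c\<^sup>2 * L) * (norm D)\<^sup>2"
    using L c unfolding power2_norm_eq_inner
    by (simp add: inner_simps inner_commute field_simps power2_eq_square)
  also have "\<dots> \<ge> 0" using L c by simp
  finally have "inner (2 *\<^sub>R g - (L / c) *\<^sub>R (y - z)) (y' - p)
    \<le> L / 2 * (norm (z - p))\<^sup>2 + (c - 1 / 2) * ((norm g)\<^sup>2 / L)"
    unfolding G y' w_def by simp
  then show ?thesis by (simp only: inner_diff_left[of "2 *\<^sub>R g"] inner_scaleR_left[of 2])
qed

theorem theorem5p3:
  fixes f :: "'a::{real_inner,complete_space} \<Rightarrow> real"
    and x y z :: "nat \<Rightarrow> 'a" and xstar :: 'a
    and \<theta> :: "nat \<Rightarrow> real" and L R :: real and N :: nat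
  assumes nonzero: "\<exists>v::'a. v \<noteq> 0"
    and L: "L > 0"
    and convex: "convex_on UNIV f"
    and differentiable: "\<forall>u. f differentiable (at u)"
    and smooth: "L_smooth L f"
    and minimizer: "\<forall>u. f xstar \<le> f u"
    and N: "N \<ge> 1"
    and R: "R \<ge> 0"
    and init_dist: "norm (x 0 - xstar) \<le> R"
    and theta_0: "\<theta> 0 = 1"
    and theta_Suc: "\<forall>k < N - 1. \<theta> (k + 1) = (1 + sqrt (1 + 4 * (\<theta> k)\<^sup>2)) / 2"
    and y_0: "y 0 = x 0"
    and z_0: "z 0 = x 0"
    and y_Suc: "\<forall>k < N. y (k + 1) = x k - (1 / L) *\<^sub>R gradient f (x k)"
    and z_Suc: "\<forall>k < N. z (k + 1) = z k - (2 * \<theta> k / L) *\<^sub>R gradient f (x k)"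
    and x_Suc: "\<forall>k < N - 1. x (k + 1) =
                  (1 - 1 / \<theta> (k + 1)) *\<^sub>R y (k + 1) + (1 / \<theta> (k + 1)) *\<^sub>R z (k + 1)"
  shows "f (y N) - f xstar \<le> L * R\<^sup>2 / (2 * (2 * (\<theta> (N - 1))\<^sup>2 + 1))"
proof -
  define P where "P u = grad_step L f u" for u
  define \<phi> where "\<phi> u = prox_value L f u" for u
  define g where "g u = gradient f u" for u
  define c where "c = (\<theta> (N - 1))\<^sup>2"
  let ?y = "y N" and ?z = "z N" and ?x = "x (N - 1)"
  have tangent: "\<phi> v + inner (g v) (P u - P v) \<le> \<phi> u" for u v
    unfolding \<phi>_def g_def P_def by (rule prox_value_above_tangent[OF L convex differentiable smooth])
  have ge_1: "1 \<le> \<theta> k" if "k < N" for k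
    by (rule theta_ge_1[OF theta_0 theta_Suc that])
  have square: "(\<theta> (Suc k))\<^sup>2 = \<theta> (Suc k) + (\<theta> k)\<^sup>2" if "Suc k < N" for k
    by (rule theta_Suc_square[OF theta_Suc that])
  have c_ge_1: "1 \<le> c" using ge_1[of "N - 1"] N by (simp add: c_def)
  have g_xstar: "g xstar = 0"
    unfolding g_def by (rule gradient_at_minimizer[OF L differentiable smooth minimizer])
  have P_xstar: "P xstar = xstar" and \<phi>_xstar: "\<phi> xstar = f xstar"
    using g_xstar by (simp_all add: P_def \<phi>_def g_def grad_step_def prox_value_def)
  have P_y: "P (x k) = y (Suc k)" if "k < N" for k
    using y_Suc that by (simp add: P_def grad_step_def)
  have P_def': "P u = u - (1 / L) *\<^sub>R g u" for u by (simp add: P_def g_def grad_step_def)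
  have P_0: "P (x 0) = z 0 - (1 / L) *\<^sub>R g (x 0)" by (simp add: P_def' z_0)
  have z_Suc': "z (Suc k) = z k - (2 * \<theta> k / L) *\<^sub>R g (x k)" if "k < N" for k
    using z_Suc that by (simp add: g_def)
  have P_Suc: "(\<theta> (Suc k))\<^sup>2 *\<^sub>R P (x (Suc k)) =
      (\<theta> k)\<^sup>2 *\<^sub>R P (x k) + \<theta> (Suc k) *\<^sub>R z (Suc k) - ((\<theta> (Suc k))\<^sup>2 / L) *\<^sub>R g (x (Suc k))"
    if k: "Suc k < N" for k
  proof -
    let ?t = "\<theta> (Suc k)"
    have t: "?t \<ge> 1" using ge_1 k by simp
    have "?t\<^sup>2 *\<^sub>R x (Suc k) = (?t\<^sup>2 * (1 - 1 / ?t)) *\<^sub>R P (x k) + (?t\<^sup>2 * (1 / ?t)) *\<^sub>R z (Suc k)"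
      using x_Suc k P_y[of k] by (simp add: scaleR_add_right)
    also have "?t\<^sup>2 * (1 - 1 / ?t) = (\<theta> k)\<^sup>2"
      using square[OF k] t by (simp add: power2_eq_square field_simps)
    also have "?t\<^sup>2 * (1 / ?t) = ?t" using t by (simp add: power2_eq_square)
    finally show ?thesis by (simp add: P_def'[of "x (Suc k)"] scaleR_diff_right)
  qed
  \<comment> \<open>How far the tangent at the \<open>j\<close>-th iterate lies below the minimum at \<open>xstar\<close>.\<close>
  define gap where "gap j = f xstar - \<phi> (x j) - inner (g (x j)) (xstar - P (x j))" for j
  have potential: "2 * c * (\<phi> ?x - f xstar) + L / 2 * (norm (?z - xstar))\<^sup>2
      + (\<Sum>j\<le>N - 1. 2 * \<theta> j * gap j) \<le> L / 2 * (norm (x 0 - xstar))\<^sup>2"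
    using ogm_potential[where \<phi> = "\<lambda>k. \<phi> (x k)" and g = "\<lambda>k. g (x k)" and P = "\<lambda>k. P (x k)"
        and z = z and k = "N - 1" and N = N and v = "f xstar" and u = xstar,
        OF L theta_0 square tangent P_0 P_Suc z_Suc'] N
    by (simp add: c_def gap_def z_0)
  have Y: "(\<Sum>j\<le>N - 1. reroute_weight (\<theta> j) *\<^sub>R g (x j)) = (L * c) *\<^sub>R (?y - ?z)"
    using sum_reroute_weight_gradient[where g = "\<lambda>k. g (x k)" and P = "\<lambda>k. P (x k)"
        and z = z and k = "N - 1" and N = N, OF L theta_0 square P_0 P_Suc z_Suc'] N P_y[of "N - 1"]
    by (simp add: c_def)
  have weights: "(\<Sum>j\<le>N - 1. reroute_weight (\<theta> j)) = c\<^sup>2"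
    unfolding c_def using N by (intro sum_reroute_weight[OF theta_0 square]) auto
  \<comment> \<open>Rerouting: in each gap a share of the weight is tested at \<open>P ?y\<close> instead of at \<open>xstar\<close>.\<close>
  have "c\<^sup>2 * (f xstar - \<phi> ?y) + inner ((L * c) *\<^sub>R (?y - ?z)) (P ?y - xstar)
      = (\<Sum>j\<le>N - 1. reroute_weight (\<theta> j) * (f xstar - \<phi> ?y + inner (g (x j)) (P ?y - xstar)))"
    by (simp add: distrib_left sum.distrib inner_sum_left flip: weights Y sum_distrib_right)
  also have "\<dots> \<le> (\<Sum>j\<le>N - 1. c\<^sup>2 * (2 * \<theta> j * gap j))"
  proof (rule sum_mono)
    fix j assume "j \<in> {..N - 1}"
    then have j: "j < N" "j \<le> N - 1" using N by auto
    have "0 \<le> gap j" using tangent[of "x j" xstar] by (simp add: gap_def P_xstar \<phi>_xstar)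
    moreover have "f xstar - \<phi> ?y + inner (g (x j)) (P ?y - xstar) \<le> gap j"
      using tangent[of "x j" ?y] by (simp add: gap_def inner_diff_right)
    moreover have "0 \<le> reroute_weight (\<theta> j)"
      using ge_1[OF j(1)] by (simp add: reroute_weight_def)
    moreover have "reroute_weight (\<theta> j) \<le> c\<^sup>2 * (2 * \<theta> j)"
      unfolding c_def using ge_1[OF j(1)] N
      by (intro reroute_weight_le theta_power2_mono[where N = N] ge_1 square j) auto
    ultimately have "reroute_weight (\<theta> j) * (f xstar - \<phi> ?y + inner (g (x j)) (P ?y - xstar))
        \<le> reroute_weight (\<theta> j) * gap j" "reroute_weight (\<theta> j) * gap j \<le> c\<^sup>2 * (2 * \<theta> j) * gap j"
      by (auto intro!: mult_left_mono mult_right_mono)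
    then show "reroute_weight (\<theta> j) * (f xstar - \<phi> ?y + inner (g (x j)) (P ?y - xstar))
        \<le> c\<^sup>2 * (2 * \<theta> j * gap j)" by (simp add: mult.assoc)
  qed
  also have "\<dots> = c\<^sup>2 * (\<Sum>j\<le>N - 1. 2 * \<theta> j * gap j)" by (simp add: sum_distrib_left)
  finally have "c\<^sup>2 * (f xstar - \<phi> ?y + inner ((L / c) *\<^sub>R (?y - ?z)) (P ?y - xstar))
      \<le> c\<^sup>2 * (\<Sum>j\<le>N - 1. 2 * \<theta> j * gap j)"
    using c_ge_1 by (simp add: distrib_left power2_eq_square algebra_simps)
  then have gaps: "f xstar - \<phi> ?y + inner ((L / c) *\<^sub>R (?y - ?z)) (P ?y - xstar)
      \<le> (\<Sum>j\<le>N - 1. 2 * \<theta> j * gap j)"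
    using c_ge_1 by (simp add: mult_le_cancel_left)
  define q where "q = (norm (g ?y))\<^sup>2 / L"
  have "\<phi> ?y + q \<le> \<phi> ?x"
    using tangent[of ?y ?x] P_y[of "N - 1"] N
    by (simp add: P_def'[of ?y] q_def power2_norm_eq_inner)
  then have "2 * c * (\<phi> ?y + q) \<le> 2 * c * \<phi> ?x"
    using c_ge_1 by (intro mult_left_mono) simp_all
  moreover have "\<phi> ?y \<le> f xstar + inner (g ?y) (P ?y - xstar)"
    using tangent[of ?y xstar] by (simp add: P_xstar \<phi>_xstar inner_diff_right)
  moreover have "2 * inner (g ?y) (P ?y - xstar) - inner ((L / c) *\<^sub>R (?y - ?z)) (P ?y - xstar)
      \<le> L / 2 * (norm (?z - xstar))\<^sup>2 + (c - 1 / 2) * q"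
    unfolding P_def'[of ?y] q_def by (rule final_quadratic_bound[OF L c_ge_1])
  moreover have "f ?y = \<phi> ?y + q / 2"
    by (simp add: \<phi>_def g_def q_def prox_value_def)
  ultimately have "(2 * c + 1) * (f ?y - f xstar) \<le> L / 2 * (norm (x 0 - xstar))\<^sup>2"
    using potential gaps by (simp add: algebra_simps
      del: inner_diff_right inner_diff_left inner_scaleR_left scaleR_diff_right)
  also have "\<dots> \<le> L / 2 * R\<^sup>2"
    using L init_dist by (intro mult_left_mono power_mono) auto
  finally show ?thesis
    using c_ge_1 unfolding c_def[symmetric] by (simp add: field_simps)
qed

end
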